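(* For every 5-dimensional subalgebra $B$ of $M_3(\mathbb{C})$ there is a map $\varphi\colon M_3(\mathbb{C})\to M_3(\mathbb{C})$, which is an automorphism or an antiautomorphism of $M_3(\mathbb{C})$, such that $\varphi(B)$ is one of the following subalgebras: 1) $\mathrm{Span}\{e_{11},e_{22},e_{23},e_{32},e_{33}\}$; 2) $\mathrm{Span}\{e_{11},e_{12},e_{13},e_{22},e_{33}\}$; 3) $\mathrm{Span}\{e_{11},e_{12},e_{13},e_{23},e_{22}+e_{33}\}$; 4) $\mathrm{Span}\{e_{11},e_{12},e_{13},e_{22},e_{23}\}$; 5) $\mathrm{Span}\{e_{11},e_{12},e_{13},e_{23},e_{33}\}$; 6) $\mathrm{Span}\{e_{11}+e_{33},e_{12},e_{13},e_{22},e_{23}\}$.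
   Context: $M_3(\mathbb{C})$ is the algebra of $3\times3$ complex matrices, $e_{ij}$ are the matrix units, and $\mathrm{Span}$ means linear span over $\mathbb{C}$. A subalgebra is a $\mathbb{C}$-linear subspace closed under multiplication; it is not required to contain the identity matrix. An automorphism is a $\mathbb{C}$-algebra automorphism of $M_3(\mathbb{C})$; an antiautomorphism is the composition of an automorphism and the transpose map. *)

theory Defs
  imports "HOL-Analysis.Analysis"
begin

type_synonym M3 = "complex^3^3"

text \<open>
  The library provides \<^term>\<open>scaleR\<close> on matrices only over the reals, and \<open>*s\<close> on
  \<^typ>\<open>complex^3^3\<close> would take scalars in \<^typ>\<open>complex^3\<close>. The complex vector space
  structure is therefore interpreted here.
\<close>

definition cscale :: "complex \<Rightarrow> M3 \<Rightarrow> M3"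
  where "cscale c A = (\<chi> i j. c * A $ i $ j)"

interpretation M3: vector_space cscale
  by unfold_locales (simp_all add: cscale_def vec_eq_iff algebra_simps)

text \<open>The type \<^typ>\<open>3\<close> has elements \<open>1\<close>, \<open>2\<close> and \<open>3\<close> (with \<open>3 = 0\<close>).\<close>

definition e :: "3 \<Rightarrow> 3 \<Rightarrow> M3"
  where "e i j = axis i (axis j 1)"

lemma e_nth: "e i j $ k $ l = (if k = i \<and> l = j then 1 else 0)"
  by (simp add: e_def axis_def)

definition subalgebra :: "M3 set \<Rightarrow> bool"
  where "subalgebra B \<longleftrightarrow> M3.subspace B \<and> (\<forall>X\<in>B. \<forall>Y\<in>B. X ** Y \<in> B)"

definition automorphism :: "(M3 \<Rightarrow> M3) \<Rightarrow> bool"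
  where "automorphism \<phi> \<longleftrightarrow>
    Vector_Spaces.linear cscale cscale \<phi> \<and> bij \<phi> \<and> (\<forall>X Y. \<phi> (X ** Y) = \<phi> X ** \<phi> Y)"

lemma automorphism_unit:
  assumes "automorphism \<phi>"
  shows "\<phi> (mat 1) = mat 1"
proof -
  have mult: "\<phi> (X ** Y) = \<phi> X ** \<phi> Y" for X Y
    using assms by (simp add: automorphism_def)
  obtain X where X: "\<phi> X = mat 1"
    using assms unfolding automorphism_def by (metis bij_pointE)
  have "\<phi> (mat 1) = \<phi> X ** \<phi> (mat 1)"
    by (simp add: X)
  also have "\<dots> = mat 1"
    using mult[of X "mat 1"] by (simp add: X)
  finally show ?thesis .
qed

definition antiautomorphism :: "(M3 \<Rightarrow> M3) \<Rightarrow> bool"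
  where "antiautomorphism \<phi> \<longleftrightarrow> (\<exists>\<psi>. automorphism \<psi> \<and> \<phi> = \<psi> \<circ> transpose)"

end

theory Submission
  imports Defs
begin

text \<open>
  The idea is to find as large an invariant flag as possible and then to read off the algebra from
  the shape of its matrices.

  A 5-dimensional algebra \<open>B\<close> does not act transitively on the nonzero vectors: a count of independent
  elements (\<open>proper_orbit_exists\<close>) shows that transitivity would force dimension at least 6. So \<open>B\<close> leaves
  a line or a plane invariant. An invariant plane becomes an invariant line after transposing, so up
  to an automorphism or antiautomorphism the first basis vector is a common eigenvector
  (\<open>equivalent_first_column\<close>) and the matrices are block triangular with a lower right 2 by 2 block.

  By Burnside's theorem for 2 by 2 matrices (\<open>block_burnside\<close>) the blocks either are arbitrary or
  have a common eigenvector. If they are arbitrary, the remaining dimension is an idempotent of rank one in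
  the first row, which splits the block off (\<open>classified_if_block_full\<close>): this is the first normal form.

  Otherwise \<open>B\<close> is conjugate to an algebra of upper triangular matrices. These have dimension 6, so
  \<open>B\<close> is a hyperplane in them, and it only remains to see which linear equations define a set closed under
  multiplication (\<open>classified_if_upper_triangular\<close>). Up to unipotent conjugation, the equation says that an
  entry next to the diagonal vanishes, that a diagonal entry vanishes, or that two diagonal entries
  agree. Reflection in the secondary diagonal identifies some of these possibilities, and the
  other five normal forms remain.
\<close>

section \<open>Matrices in coordinates\<close>

lemma matrix_mult_nth:
  fixes X Y :: M3
  shows "(X ** Y) $ i $ j = X $ i $ 1 * Y $ 1 $ j + X $ i $ 2 * Y $ 2 $ j + X $ i $ 3 * Y $ 3 $ j"
  by (simp add: matrix_matrix_mult_def sum_3)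

lemma matrix_vector_mult_nth:
  fixes X :: M3
  shows "(X *v v) $ i = X $ i $ 1 * v $ 1 + X $ i $ 2 * v $ 2 + X $ i $ 3 * v $ 3"
  by (simp add: matrix_vector_mult_def sum_3)

lemma cscale_nth: "cscale c X $ i $ j = c * X $ i $ j"
  by (simp add: cscale_def)

lemma M3_eq_iff: "X = Y \<longleftrightarrow> (\<forall>i j. X $ i $ j = Y $ i $ j)" for X Y :: M3
  by (simp add: vec_eq_iff)

lemmas nth_simps = matrix_mult_nth matrix_vector_mult_nth cscale_nth e_nth transpose_def mat_def

lemma cscale_mult_vec: "cscale c X *v v = c *s (X *v v)"
  by (simp add: vec_eq_iff nth_simps algebra_simps)

lemma subalgebraD:
  assumes "subalgebra B"
  shows "X \<in> B \<Longrightarrow> Y \<in> B \<Longrightarrow> X + Y \<in> B" and "X \<in> B \<Longrightarrow> Y \<in> B \<Longrightarrow> X - Y \<in> B"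
    and "X \<in> B \<Longrightarrow> cscale c X \<in> B" and "X \<in> B \<Longrightarrow> Y \<in> B \<Longrightarrow> X ** Y \<in> B" and "0 \<in> B"
  using assms by (auto simp: subalgebra_def M3.subspace_add M3.subspace_diff M3.subspace_scale M3.subspace_0)

lemma matrix_unit_expansion: "X = (\<Sum>(i, j)\<in>UNIV. cscale (X $ i $ j) (e i j))"
  by (simp add: M3_eq_iff UNIV_Times_UNIV[symmetric] sum.cartesian_product[symmetric]
      sum_3 forall_3 nth_simps del: UNIV_Times_UNIV)

section \<open>Dimension and linear functionals\<close>

abbreviation matrix_units :: "M3 set"
  where "matrix_units \<equiv> range (\<lambda>(i, j). e i j)"

lemma inj_matrix_units: "inj (\<lambda>(i, j). e i j)"
  by (auto simp: inj_def M3_eq_iff e_nth; metis zero_neq_one)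

interpretation M3: finite_dimensional_vector_space cscale matrix_units
proof
  show "finite matrix_units" by simp
  show "M3.independent matrix_units"
  proof (rule M3.independent_if_scalars_zero)
    fix f x
    assume "(\<Sum>x\<in>matrix_units. cscale (f x) x) = 0" and "x \<in> matrix_units"
    then obtain i j where x: "x = e i j" by auto
    have z: "(\<Sum>(i, j)\<in>UNIV. cscale (f (e i j)) (e i j)) = 0"
      using \<open>(\<Sum>x\<in>matrix_units. cscale (f x) x) = 0\<close>
      by (subst (asm) sum.reindex[OF inj_matrix_units]) (simp add: comp_def case_prod_beta)
    have "(\<Sum>(i, j)\<in>UNIV. cscale (f (e i j)) (e i j)) $ i $ j = f (e i j)"
      using exhaust_3[of i] exhaust_3[of j]
      by (auto simp: UNIV_Times_UNIV[symmetric] sum.cartesian_product[symmetric]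
         sum_3 nth_simps simp del: UNIV_Times_UNIV)
    then show "f x = 0" by (simp add: x z)
  qed simp
  have "X \<in> M3.span matrix_units" for X
    by (subst matrix_unit_expansion) (intro M3.span_sum, auto intro!: M3.span_scale intro: M3.span_base)
  then show "M3.span matrix_units = UNIV" by blast
qed

lemma dim_upper_bound:
  assumes "finite I" and "\<And>X. X \<in> S \<Longrightarrow> \<exists>c. X = (\<Sum>i\<in>I. cscale (c i) (y i))"
  shows "M3.dim S \<le> card I"
proof -
  have "S \<subseteq> M3.span (y ` I)"
  proof
    fix X assume "X \<in> S"
    then obtain c where "X = (\<Sum>i\<in>I. cscale (c i) (y i))" using assms(2) by blast
    then show "X \<in> M3.span (y ` I)"
      by (auto intro: M3.span_sum M3.span_scale M3.span_base)
  qed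
  then have "M3.dim S \<le> card (y ` I)" by (rule M3.dim_le_card) (simp add: assms)
  also have "\<dots> \<le> card I" by (rule card_image_le) fact
  finally show ?thesis .
qed

lemma dim_lower_bound:
  assumes "finite I" and "\<And>i. i \<in> I \<Longrightarrow> y i \<in> S"
    and zero: "\<And>c i. (\<Sum>i\<in>I. cscale (c i) (y i)) = 0 \<Longrightarrow> i \<in> I \<Longrightarrow> c i = 0"
  shows "card I \<le> M3.dim S"
proof -
  have inj: "inj_on y I"
  proof (rule inj_onI, rule ccontr)
    fix a b assume ab: "a \<in> I" "b \<in> I" "y a = y b" "a \<noteq> b"
    let ?c = "\<lambda>i. if i = a then 1 else if i = b then -1 else 0 :: complex"
    have "(\<Sum>i\<in>I. cscale (?c i) (y i)) = (\<Sum>i\<in>{a, b}. cscale (?c i) (y i))"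
      by (rule sum.mono_neutral_right) (use ab assms(1) in auto)
    also have "\<dots> = 0" using ab by simp
    finally show False using zero[of ?c a] ab by simp
  qed
  have "M3.independent (y ` I)"
  proof (rule M3.independent_if_scalars_zero)
    fix f x assume "(\<Sum>x\<in>y ` I. cscale (f x) x) = 0" "x \<in> y ` I"
    then show "f x = 0"
      using zero[of "\<lambda>i. f (y i)"] by (auto simp: sum.reindex[OF inj])
  qed (use assms in simp)
  then have "card (y ` I) \<le> M3.dim S"
    using assms(2) by (intro M3.independent_card_le_dim) auto
  then show ?thesis by (simp add: card_image[OF inj])
qed

text \<open>
  A basis of the subspace stays independent when the outside vector is added to it; the functional is
  prescribed on the enlarged basis and extended to the whole space.
\<close>
lemma separating_functional:
  fixes s :: "'a::field \<Rightarrow> 'b::ab_group_add \<Rightarrow> 'b"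
  assumes "vector_space s" and sub: "module.subspace s S" and u: "u \<notin> S"
  obtains f where "Vector_Spaces.linear s (*) f" and "\<And>x. x \<in> S \<Longrightarrow> f x = 0" and "f u = 1"
proof -
  interpret V: vector_space s by fact
  interpret P: vector_space_pair s "(*)"
    by (intro vector_space_pair.intro assms) (unfold_locales, auto simp: algebra_simps)
  obtain b where b: "b \<subseteq> S" "V.independent b" "S \<subseteq> V.span b"
    by (rule V.basis_exists)
  have "V.span b \<subseteq> S" using b(1) sub by (simp add: V.span_minimal)
  then have ub: "u \<notin> V.span b" using u by blast
  then have "V.independent (insert u b)" by (intro V.independent_insertI b)
  from P.linear_independent_extend[OF this, of "\<lambda>x. if x = u then 1 else 0"]
  obtain f where f: "Vector_Spaces.linear s (*) f" "\<forall>x\<in>insert u b. f x = (if x = u then 1 else 0)" by blast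
  have fb: "f x = 0" if "x \<in> b" for x using f(2) that ub V.span_base by auto
  have "f x = 0" if "x \<in> S" for x
    using P.linear_eq_on[OF f(1) P.module_hom_zero[unfolded module_hom_iff_linear], of x b] that fb b by auto
  then show thesis using that f by auto
qed

lemma functional_expansion:
  assumes "Vector_Spaces.linear cscale (*) f"
  shows "f X = (\<Sum>i\<in>UNIV. \<Sum>j\<in>UNIV. f (e i j) * X $ i $ j)"
proof -
  interpret Vector_Spaces.linear cscale "(*)" f by fact
  have "f X = (\<Sum>(i, j)\<in>UNIV. f (e i j) * X $ i $ j)"
    by (subst matrix_unit_expansion[of X]) (simp add: sum scale case_prod_beta mult.commute)
  then show ?thesis
    by (simp add: UNIV_Times_UNIV[symmetric] sum.cartesian_product[symmetric] del: UNIV_Times_UNIV)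
qed

section \<open>Equivalence of subalgebras\<close>

lemma linear_cscaleI:
  assumes "\<And>X Y. f (X + Y) = f X + f Y" and "\<And>c X. f (cscale c X) = cscale c (f X)"
  shows "Vector_Spaces.linear cscale cscale f"
  using assms by unfold_locales auto

lemma transpose_add: "transpose (X + Y) = transpose X + transpose Y" for X Y :: M3
  by (simp add: M3_eq_iff transpose_def)

lemma transpose_cscale: "transpose (cscale c X) = cscale c (transpose X)"
  by (simp add: M3_eq_iff nth_simps)

lemma bij_transpose: "bij (transpose :: M3 \<Rightarrow> M3)"
  by (rule involuntory_imp_bij) simp

lemma automorphism_compose:
  assumes "automorphism \<phi>" and "automorphism \<psi>"
  shows "automorphism (\<psi> \<circ> \<phi>)"
  using assms by (auto simp: automorphism_def intro: bij_comp Vector_Spaces.linear_compose)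

text \<open>
  Both transpositions reverse products, so between them they preserve the order of multiplication. This is
  what makes compositions of antiautomorphisms with automorphisms stay automorphisms or antiautomorphisms.
\<close>
lemma automorphism_transpose_sandwich:
  assumes "automorphism \<phi>"
  shows "automorphism (transpose \<circ> \<phi> \<circ> transpose)"
proof -
  interpret Vector_Spaces.linear cscale cscale \<phi>
    using assms by (simp add: automorphism_def)
  have "Vector_Spaces.linear cscale cscale (transpose \<circ> \<phi> \<circ> transpose)"
    by (rule linear_cscaleI) (simp_all add: transpose_add transpose_cscale add scale)
  moreover have "bij (transpose \<circ> \<phi> \<circ> transpose)"
    using assms by (auto simp: automorphism_def intro!: bij_comp bij_transpose)
  ultimately show ?thesis
    using assms by (simp add: automorphism_def matrix_transpose_mul)
qed

lemma automorphism_conjugation: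
  assumes "P ** Q = mat 1" and "Q ** P = mat 1"
  shows "automorphism (\<lambda>X. Q ** X ** P)"
proof -
  have "Vector_Spaces.linear cscale cscale (\<lambda>X. Q ** X ** P)"
    by (rule linear_cscaleI) (simp_all add: M3_eq_iff nth_simps algebra_simps)
  moreover have "bij (\<lambda>X. Q ** X ** P)"
  proof (rule bijI')
    show "Q ** X ** P = Q ** Y ** P \<longleftrightarrow> X = Y" for X Y
      by (metis assms matrix_mul_assoc matrix_mul_lid matrix_mul_rid)
    show "\<exists>X. Y = Q ** X ** P" for Y
      by (rule exI[of _ "P ** Y ** Q"])
         (metis assms matrix_mul_assoc matrix_mul_lid matrix_mul_rid)
  qed
  moreover have "Q ** (X ** Y) ** P = (Q ** X ** P) ** (Q ** Y ** P)" for X Y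
    by (metis assms matrix_mul_assoc matrix_mul_rid)
  ultimately show ?thesis by (simp add: automorphism_def)
qed

text \<open>
  The reduction replaces an algebra by an equivalent one several times, by conjugations and the transpose. It
  only uses that this relation is transitive and preserves subalgebras and their dimension.
\<close>
definition equivalent :: "M3 set \<Rightarrow> M3 set \<Rightarrow> bool"
  where "equivalent B C \<longleftrightarrow> (\<exists>\<phi>. (automorphism \<phi> \<or> antiautomorphism \<phi>) \<and> \<phi> ` B = C)"

lemma equivalent_trans:
  assumes "equivalent A B" and "equivalent B C"
  shows "equivalent A C"
proof -
  obtain \<phi> \<psi> where \<phi>: "automorphism \<phi> \<or> antiautomorphism \<phi>" "\<phi> ` A = B"
    and \<psi>: "automorphism \<psi> \<or> antiautomorphism \<psi>" "\<psi> ` B = C"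
    using assms by (auto simp: equivalent_def)
  have "automorphism (\<psi> \<circ> \<phi>) \<or> antiautomorphism (\<psi> \<circ> \<phi>)"
  proof -
    have 1: "antiautomorphism (\<psi>' \<circ> \<phi>')" if "automorphism \<psi>'" "antiautomorphism \<phi>'" for \<psi>' \<phi>'
      using that automorphism_compose unfolding antiautomorphism_def by (metis comp_assoc)
    have 2: "antiautomorphism (\<psi>' \<circ> transpose \<circ> \<phi>')" if "automorphism \<psi>'" "automorphism \<phi>'" for \<psi>' \<phi>'
    proof -
      have "automorphism (\<psi>' \<circ> (transpose \<circ> \<phi>' \<circ> transpose))"
        by (intro automorphism_compose automorphism_transpose_sandwich that)
      moreover have "\<psi>' \<circ> transpose \<circ> \<phi>' = \<psi>' \<circ> (transpose \<circ> \<phi>' \<circ> transpose) \<circ> transpose"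
        by (simp add: fun_eq_iff)
      ultimately show ?thesis unfolding antiautomorphism_def by blast
    qed
    have 3: "automorphism (\<psi>' \<circ> transpose \<circ> (\<phi>' \<circ> transpose))" if "automorphism \<psi>'" "automorphism \<phi>'" for \<psi>' \<phi>'
      using automorphism_compose[OF automorphism_transpose_sandwich[OF that(2)] that(1)]
      by (simp add: comp_assoc)
    have 4: "automorphism (\<psi> \<circ> \<phi>)" if an: "antiautomorphism \<psi>" "antiautomorphism \<phi>"
      using an 3 unfolding antiautomorphism_def by auto
    have 5: "antiautomorphism (\<psi> \<circ> \<phi>)" if an: "antiautomorphism \<psi>" "automorphism \<phi>"
      using an(1) 2[OF _ an(2)] unfolding antiautomorphism_def[of \<psi>] by auto
    show ?thesis
      using \<phi>(1) \<psi>(1) 1 4 5 automorphism_compose by blast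
  qed
  moreover have "(\<psi> \<circ> \<phi>) ` A = C" using \<phi>(2) \<psi>(2) by (metis image_comp)
  ultimately show ?thesis unfolding equivalent_def by blast
qed

lemma equivalent_conjugate:
  assumes "P ** Q = mat 1" and "Q ** P = mat 1"
  shows "equivalent B ((\<lambda>X. Q ** X ** P) ` B)"
  using automorphism_conjugation[OF assms] by (auto simp: equivalent_def)

lemma equivalent_transpose: "equivalent B (transpose ` B)"
proof -
  have "automorphism (\<lambda>X. mat 1 ** X ** mat 1)"
    by (rule automorphism_conjugation) simp_all
  then have "antiautomorphism transpose"
    unfolding antiautomorphism_def by (intro exI[of _ id]) (simp add: id_def fun_eq_iff)
  then show ?thesis by (auto simp: equivalent_def)
qed

lemma equivalent_linear_bij:
  assumes "equivalent B C"
  obtains \<phi> where "Vector_Spaces.linear cscale cscale \<phi>" and "inj \<phi>" and "\<phi> ` B = C"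
    and "(\<forall>X Y. \<phi> (X ** Y) = \<phi> X ** \<phi> Y) \<or> (\<forall>X Y. \<phi> (X ** Y) = \<phi> Y ** \<phi> X)"
proof -
  from assms obtain \<phi> where \<phi>: "automorphism \<phi> \<or> antiautomorphism \<phi>" "\<phi> ` B = C"
    by (auto simp: equivalent_def)
  have "Vector_Spaces.linear cscale cscale transpose"
    by (rule linear_cscaleI) (simp_all add: transpose_add transpose_cscale)
  then have "Vector_Spaces.linear cscale cscale \<phi>"
    using \<phi>(1) by (auto simp: automorphism_def antiautomorphism_def intro: Vector_Spaces.linear_compose)
  moreover have "inj \<phi>"
    using \<phi>(1) bij_transpose
    by (auto simp: automorphism_def antiautomorphism_def intro: bij_comp bij_is_inj)
  moreover have "(\<forall>X Y. \<phi> (X ** Y) = \<phi> X ** \<phi> Y) \<or> (\<forall>X Y. \<phi> (X ** Y) = \<phi> Y ** \<phi> X)"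
    using \<phi>(1) by (auto simp: automorphism_def antiautomorphism_def matrix_transpose_mul)
  ultimately show thesis using that \<phi>(2) by blast
qed

lemma equivalent_subalgebra:
  assumes "equivalent B C" and "subalgebra B"
  shows "subalgebra C"
proof -
  obtain \<phi> where \<phi>: "Vector_Spaces.linear cscale cscale \<phi>" "\<phi> ` B = C"
    "(\<forall>X Y. \<phi> (X ** Y) = \<phi> X ** \<phi> Y) \<or> (\<forall>X Y. \<phi> (X ** Y) = \<phi> Y ** \<phi> X)"
    by (rule equivalent_linear_bij[OF assms(1)]) blast
  interpret Vector_Spaces.linear cscale cscale \<phi> by fact
  have "M3.subspace C"
    using assms(2) subspace_image \<phi>(2) by (auto simp: subalgebra_def)
  moreover have "X ** Y \<in> B" if "X \<in> B" "Y \<in> B" for X Y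
    using assms(2) that by (simp add: subalgebra_def)
  then have "\<phi> X ** \<phi> Y \<in> C" if "X \<in> B" "Y \<in> B" for X Y
    using that \<phi>(2,3) by (metis imageI)
  ultimately show ?thesis
    using \<phi>(2) by (auto simp: subalgebra_def)
qed

lemma equivalent_dim:
  assumes "equivalent B C"
  shows "M3.dim C = M3.dim B"
proof -
  obtain \<phi> where \<phi>: "Vector_Spaces.linear cscale cscale \<phi>" "inj \<phi>" "\<phi> ` B = C"
    by (rule equivalent_linear_bij[OF assms]) blast
  interpret P: finite_dimensional_vector_space_pair_1 cscale matrix_units cscale
    by unfold_locales
  show ?thesis
    using P.dim_image_eq[OF \<phi>(1)] \<phi>(2,3) by (metis inj_on_subset subset_UNIV)
qed

text \<open>
  In each case of the classification only linear relations between the entries are derived, which give an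
  inclusion in one of the normal forms; counting dimensions turns it into an equality.
\<close>
lemma eq_span_of_dim_5:
  assumes "subalgebra C" and "M3.dim C = 5" and "card E \<le> 5" and "finite E"
    and "C \<subseteq> M3.span E"
  shows "C = M3.span E"
proof (rule M3.subspace_dim_equal)
  have "M3.dim (M3.span E) \<le> card E"
    by (rule M3.dim_le_card) (use assms in auto)
  then show "M3.dim (M3.span E) \<le> M3.dim C" using assms by simp
qed (use assms in \<open>auto simp: subalgebra_def\<close>)

lemma five_term_sum_in_span:
  "X = cscale a A + cscale b B + cscale c C + cscale d D + cscale f F \<Longrightarrow> X \<in> M3.span {A, B, C, D, F}"
  by (auto intro!: M3.span_add M3.span_scale[OF M3.span_base])

section \<open>An invariant line or plane\<close>

text \<open>
  If every nonzero vector generated the whole space, then three elements \<open>Y i\<close> of the algebra would map a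
  fixed \<open>v\<close> to the standard basis. As the dimension exceeds 3, some nonzero \<open>X\<close> in the algebra would kill \<open>v\<close>.
  Choosing \<open>v'\<close> outside the kernel of \<open>X\<close> and \<open>Z i\<close> mapping \<open>X v'\<close> to the standard basis gives three
  further elements \<open>Z i X\<close>, which kill \<open>v\<close>. Evaluating first at \<open>v\<close> and then at \<open>v'\<close> shows that all six are
  independent, which is one too many.
\<close>
lemma proper_orbit_exists:
  assumes sub: "subalgebra B" and dim: "M3.dim B = 5"
  shows "\<exists>v w. v \<noteq> 0 \<and> (\<forall>X\<in>B. X *v v \<noteq> w)"
proof (rule ccontr)
  assume "\<not> ?thesis"
  then have trans: "\<exists>X\<in>B. X *v v = w" if "v \<noteq> 0" for v w using that by blast
  note mem = subalgebraD[OF sub]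
  define v :: "complex^3" where "v = axis 1 1"
  have "v \<noteq> 0" by (simp add: v_def axis_eq_0_iff)
  have "\<forall>i. \<exists>X. X \<in> B \<and> X *v v = axis i 1"
    using trans[OF \<open>v \<noteq> 0\<close>] by blast
  from choice[OF this] obtain Y where Y: "Y i \<in> B" "Y i *v v = axis i 1" for i
    by blast
  have "\<exists>X\<in>B. \<forall>c. X \<noteq> (\<Sum>i\<in>UNIV. cscale (c i) (Y i))"
    using dim_upper_bound[of "UNIV :: 3 set" B Y] dim by force
  then obtain X0 where X0: "X0 \<in> B" "\<And>c. X0 \<noteq> (\<Sum>i\<in>UNIV. cscale (c i) (Y i))" by blast
  define X where "X = X0 - (\<Sum>i\<in>UNIV. cscale ((X0 *v v) $ i) (Y i))"
  have "X \<in> B" unfolding X_def sum_3 by (intro mem X0 Y)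
  have "X \<noteq> 0" using X0(2) by (simp add: X_def)
  have "X *v v = 0"
    by (simp add: X_def sum_3 matrix_vector_mult_diff_rdistrib matrix_vector_mult_add_rdistrib
      cscale_mult_vec Y vec_eq_iff forall_3 axis_def)
  from \<open>X \<noteq> 0\<close> obtain v' where v': "X *v v' \<noteq> 0"
    using matrix_eq[of X 0] by auto
  have "\<forall>i. \<exists>Z. Z \<in> B \<and> Z *v (X *v v') = axis i 1"
    using trans[OF v'] by blast
  from choice[OF this] obtain Z where Z: "Z i \<in> B" "Z i *v (X *v v') = axis i 1" for i
    by blast
  let ?I = "UNIV <+> UNIV :: (3 + 3) set"
  have "card ?I \<le> M3.dim B"
  proof (rule dim_lower_bound)
    show "case_sum Y (\<lambda>i. Z i ** X) i \<in> B" for i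
      by (cases i) (auto intro: mem Y Z \<open>X \<in> B\<close>)
    fix c i
    assume "(\<Sum>i\<in>?I. cscale (c i) (case_sum Y (\<lambda>i. Z i ** X) i)) = 0"
    then have sum0: "(\<Sum>i\<in>UNIV. cscale (c (Inl i)) (Y i)) + (\<Sum>i\<in>UNIV. cscale (c (Inr i)) (Z i ** X)) = 0"
      by (subst (asm) sum.Plus) simp_all
    have ZX: "(Z i ** X) *v x = Z i *v (X *v x)" for i x
      by (simp add: matrix_vector_mul_assoc)
    have l: "c (Inl i) = 0" for i
      using arg_cong[OF sum0, of "\<lambda>M. (M *v v) $ i"] exhaust_3[of i]
      by (auto simp: sum_3 matrix_vector_mult_add_rdistrib cscale_mult_vec Y ZX \<open>X *v v = 0\<close> axis_def)
    have r: "c (Inr i) = 0" for i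
      using arg_cong[OF sum0, of "\<lambda>M. (M *v v') $ i"] exhaust_3[of i]
      by (auto simp: sum_3 matrix_vector_mult_add_rdistrib cscale_mult_vec l Z ZX axis_def)
    show "c i = 0" using l r by (cases i) auto
  qed simp
  then show False using dim by (simp add: card_Plus)
qed

text \<open>
  The bilinear form without complex conjugation, since it has to be compatible with the transpose.
\<close>
definition pairing :: "complex^3 \<Rightarrow> complex^3 \<Rightarrow> complex"
  where "pairing g x = g $ 1 * x $ 1 + g $ 2 * x $ 2 + g $ 3 * x $ 3"

lemma pairing_transpose: "pairing (transpose X *v g) x = pairing g (X *v x)"
  by (simp add: pairing_def nth_simps algebra_simps)

lemma proportional_if_minors_vanish:
  fixes a b :: "complex^3"
  assumes "b \<noteq> 0" and "a $ 2 * b $ 3 = a $ 3 * b $ 2" and "a $ 3 * b $ 1 = a $ 1 * b $ 3"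
    and "a $ 1 * b $ 2 = a $ 2 * b $ 1"
  shows "\<exists>c. a = c *s b"
proof -
  obtain i where i: "b $ i \<noteq> 0" using assms(1) by (auto simp: vec_eq_iff)
  then have "a = (a $ i / b $ i) *s b"
    using assms(2-4) exhaust_3[of i] by (auto simp: vec_eq_iff forall_3 field_simps)
  then show ?thesis by blast
qed

text \<open>
  Two independent functionals on a 3-dimensional space have a common kernel of dimension 1. The proof is
  dual: if \<open>u\<close> and \<open>w\<close> were independent, then every functional vanishing on both would be a multiple of
  their cross product.
\<close>
lemma proportional_if_common_annihilators:
  assumes g: "g \<noteq> 0" and h: "\<And>c. h \<noteq> c *s g" and w: "w \<noteq> 0"
    and "pairing g w = 0" "pairing g u = 0" "pairing h w = 0" "pairing h u = 0"
  shows "\<exists>c. u = c *s w"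
proof (rule ccontr)
  assume u: "\<nexists>c. u = c *s w"
  define n :: "complex^3" where "n = vector [u $ 2 * w $ 3 - u $ 3 * w $ 2, u $ 3 * w $ 1 - u $ 1 * w $ 3,
    u $ 1 * w $ 2 - u $ 2 * w $ 1]"
  have "n \<noteq> 0"
    using u proportional_if_minors_vanish[OF w, of u] by (auto simp: n_def vec_eq_iff forall_3)
  have multiple: "\<exists>c. x = c *s n" if "pairing x w = 0" "pairing x u = 0" for x
    using that
    by (intro proportional_if_minors_vanish \<open>n \<noteq> 0\<close>; simp add: n_def pairing_def; algebra)
  obtain c d where cd: "g = c *s n" "h = d *s n"
    using multiple assms(4-7) by blast
  then have "c \<noteq> 0" using g by auto
  then have "h = (d / c) *s g" using cd by (simp add: vec_eq_iff)
  then show False using h by blast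
qed

text \<open>
  A proper orbit \<open>W = B v\<close> is an invariant subspace of dimension at most 2, hence an invariant line appears
  either for \<open>B\<close> or, through the annihilator of \<open>W\<close>, for the transposed algebra. Concretely: a functional
  \<open>g\<close> vanishing on \<open>W\<close> is a common eigenvector of the transposes, unless some transpose moves it to a
  functional \<open>h\<close> that is not a multiple of \<open>g\<close>. But \<open>h\<close> vanishes on \<open>W\<close> as well, so in that case \<open>W\<close> is a line.
\<close>
lemma common_eigenvector:
  assumes sub: "subalgebra B" and dim: "M3.dim B = 5"
  shows "\<exists>v. v \<noteq> 0 \<and> ((\<forall>X\<in>B. \<exists>c. X *v v = c *s v) \<or> (\<forall>X\<in>B. \<exists>c. transpose X *v v = c *s v))"
proof -
  note mem = subalgebraD[OF sub]
  obtain v w where "v \<noteq> 0" and w: "\<And>X. X \<in> B \<Longrightarrow> X *v v \<noteq> w"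
    using proper_orbit_exists[OF assms] by blast
  show ?thesis
  proof (cases "\<forall>X\<in>B. X *v v = 0")
    case True
    then have "\<forall>X\<in>B. \<exists>c. X *v v = c *s v" by (metis vec.scale_zero_left)
    with \<open>v \<noteq> 0\<close> show ?thesis by blast
  next
    case False
    then obtain X0 where X0: "X0 \<in> B" "X0 *v v \<noteq> 0" by blast
    define W where "W = (\<lambda>X. X *v v) ` B"
    have "vec.subspace W"
    proof (rule vec.subspaceI)
      show "0 \<in> W" using mem(5) by (force simp: W_def)
      fix x y assume "x \<in> W" "y \<in> W"
      then show "x + y \<in> W"
        by (auto simp: W_def matrix_vector_mult_add_rdistrib[symmetric] intro!: imageI mem)
    next
      fix x c assume "x \<in> W"
      then show "c *s x \<in> W"
        by (auto simp: W_def cscale_mult_vec[symmetric] intro!: imageI mem)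
    qed
    moreover have "w \<notin> W" using w by (auto simp: W_def)
    ultimately obtain f where f: "Vector_Spaces.linear (*s) (*) f" "\<And>x. x \<in> W \<Longrightarrow> f x = 0" "f w = 1"
      by (rule separating_functional[OF vec.vector_space_axioms]) blast
    interpret f: Vector_Spaces.linear "(*s)" "(*)" f by fact
    define g :: "complex^3" where "g = (\<chi> i. f (axis i 1))"
    have fg: "f x = pairing g x" for x
    proof -
      have "f x = f (x $ 1 *s axis 1 1 + x $ 2 *s axis 2 1 + x $ 3 *s axis 3 1)"
        by (rule arg_cong[where f = f]) (simp add: vec_eq_iff forall_3 axis_def)
      then show ?thesis by (simp add: f.add f.scale g_def pairing_def algebra_simps)
    qed
    have "g \<noteq> 0" using f(3) by (auto simp: fg pairing_def)
    show ?thesis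
    proof (cases "\<forall>X\<in>B. \<exists>c. transpose X *v g = c *s g")
      case True
      with \<open>g \<noteq> 0\<close> show ?thesis by blast
    next
      case False
      then obtain X1 where X1: "X1 \<in> B" "\<And>c. transpose X1 *v g \<noteq> c *s g" by blast
      have W: "X *v x \<in> W" if "X \<in> B" "x \<in> W" for X x
        using that by (auto simp: W_def matrix_vector_mul_assoc intro!: imageI mem)
      have x0: "X0 *v v \<in> W" using X0 by (auto simp: W_def)
      have "\<exists>c. X *v (X0 *v v) = c *s (X0 *v v)" if "X \<in> B" for X
        by (rule proportional_if_common_annihilators[OF \<open>g \<noteq> 0\<close> X1(2) X0(2)])
           (simp_all add: pairing_transpose fg[symmetric] f(2) W X1 x0 that del: transpose_matrix_vector)
      with X0(2) show ?thesis by blast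
    qed
  qed
qed

text \<open>
  The vector replaces a standard basis vector for which its coordinate is nonzero.
\<close>
lemma invertible_first_column:
  fixes v :: "complex^3"
  assumes "v \<noteq> 0"
  obtains P Q :: M3 where "P ** Q = mat 1" "Q ** P = mat 1" "P *v axis 1 1 = v"
proof -
  have "\<exists>P::M3. det P \<noteq> 0 \<and> P *v axis 1 1 = v"
  proof -
    consider "v $ 1 \<noteq> 0" | "v $ 2 \<noteq> 0" | "v $ 3 \<noteq> 0" using assms by (auto simp: vec_eq_iff forall_3)
    then show ?thesis
    proof cases
      case 1
      then show ?thesis
        by (intro exI[of _ "vector [vector [v$1, 0, 0], vector [v$2, 1, 0], vector [v$3, 0, 1]]"])
           (simp add: det_3 vec_eq_iff forall_3 nth_simps axis_def)
    next
      case 2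
      then show ?thesis
        by (intro exI[of _ "vector [vector [v$1, 1, 0], vector [v$2, 0, 0], vector [v$3, 0, 1]]"])
           (simp add: det_3 vec_eq_iff forall_3 nth_simps axis_def)
    next
      case 3
      then show ?thesis
        by (intro exI[of _ "vector [vector [v$1, 1, 0], vector [v$2, 0, 1], vector [v$3, 0, 0]]"])
           (simp add: det_3 vec_eq_iff forall_3 nth_simps axis_def)
    qed
  qed
  then show thesis using that by (metis invertible_det_nz invertible_def)
qed

lemma equivalent_first_column:
  assumes sub: "subalgebra B" and dim: "M3.dim B = 5"
  obtains C where "equivalent B C" and "\<And>X. X \<in> C \<Longrightarrow> X $ 2 $ 1 = 0 \<and> X $ 3 $ 1 = 0"
proof -
  have fix_line: "\<exists>C. equivalent B' C \<and> (\<forall>X\<in>C. X $ 2 $ 1 = 0 \<and> X $ 3 $ 1 = 0)"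
    if v: "v \<noteq> 0" "\<forall>X\<in>B'. \<exists>c. X *v v = c *s v" for v B'
  proof -
    obtain P Q :: M3 where PQ: "P ** Q = mat 1" "Q ** P = mat 1" "P *v axis 1 1 = v"
      using invertible_first_column[OF v(1)] by blast
    have "(Q ** X ** P) $ i $ 1 = 0" if "X \<in> B'" "i \<noteq> 1" for X i
    proof -
      obtain c where c: "X *v v = c *s v" using v(2) \<open>X \<in> B'\<close> by blast
      have "(Q ** X ** P) *v axis 1 1 = Q *v (X *v v)"
        by (simp add: matrix_vector_mul_assoc[symmetric] PQ)
      also have "\<dots> = c *s (Q *v (P *v axis 1 1))"
        by (simp add: c vec.scale PQ)
      also have "\<dots> = c *s axis 1 1"
        by (simp only: matrix_vector_mul_assoc PQ(2) matrix_vector_mul_lid)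
      finally have "((Q ** X ** P) *v axis 1 1) $ i = 0" using \<open>i \<noteq> 1\<close> by (simp add: axis_def)
      then show ?thesis by (simp add: matrix_vector_mult_nth[of "Q ** X ** P"] axis_def)
    qed
    then show ?thesis using equivalent_conjugate[OF PQ(1,2), of B'] by force
  qed
  obtain v where v: "v \<noteq> 0" "(\<forall>X\<in>B. \<exists>c. X *v v = c *s v) \<or> (\<forall>X\<in>transpose ` B. \<exists>c. X *v v = c *s v)"
    using common_eigenvector[OF assms] by auto
  from v(2) show thesis
  proof
    assume "\<forall>X\<in>B. \<exists>c. X *v v = c *s v"
    from fix_line[OF v(1) this] show thesis using that by blast
  next
    assume "\<forall>X\<in>transpose ` B. \<exists>c. X *v v = c *s v"
    from fix_line[OF v(1) this] obtain C where
      C: "equivalent (transpose ` B) C" "\<forall>X\<in>C. X $ 2 $ 1 = 0 \<and> X $ 3 $ 1 = 0" by blast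
    show thesis
      by (rule that[OF equivalent_trans[OF equivalent_transpose C(1)]]) (use C(2) in blast)
  qed
qed

section \<open>The algebra of lower right blocks\<close>

lemma quadratic_root:
  fixes a b c :: complex
  assumes "a \<noteq> 0"
  shows "\<exists>t. a * t\<^sup>2 + b * t + c = 0"
proof -
  define d where "d = csqrt (b\<^sup>2 - 4 * a * c)"
  have d: "d\<^sup>2 = b\<^sup>2 - 4 * a * c" by (simp add: d_def)
  have "4 * a * (a * ((d - b) / (2 * a))\<^sup>2 + b * ((d - b) / (2 * a)) + c) = d\<^sup>2 - (b\<^sup>2 - 4 * a * c)"
    using assms by (simp add: field_simps power2_eq_square)
  then have "a * ((d - b) / (2 * a))\<^sup>2 + b * ((d - b) / (2 * a)) + c = 0"
    using assms d by simp
  then show ?thesis ..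
qed

lemma singular_kernel_2:
  fixes a b c d :: complex
  assumes "a * d = b * c"
  shows "\<exists>p q. (p, q) \<noteq> (0, 0) \<and> a * p + b * q = 0 \<and> c * p + d * q = 0"
proof (cases "a = 0 \<and> b = 0")
  case True
  show ?thesis
  proof (cases "c = 0 \<and> d = 0")
    case True
    with \<open>a = 0 \<and> b = 0\<close> show ?thesis by (intro exI[of _ 1]) auto
  next
    case False
    with \<open>a = 0 \<and> b = 0\<close> show ?thesis by (intro exI[of _ d] exI[of _ "-c"]) auto
  qed
next
  case False
  with assms show ?thesis by (intro exI[of _ b] exI[of _ "-a"]) (auto simp: algebra_simps)
qed

lemma eigenvector_2:
  fixes a b c d :: complex
  shows "\<exists>l p q. (p, q) \<noteq> (0, 0) \<and> a * p + b * q = l * p \<and> c * p + d * q = l * q"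
proof -
  obtain l where "1 * l\<^sup>2 + - (a + d) * l + (a * d - b * c) = 0"
    using quadratic_root[of 1] by (metis zero_neq_one)
  then have "(a - l) * (d - l) = b * c" by (simp add: algebra_simps power2_eq_square)
  from singular_kernel_2[OF this] obtain p q where
    "(p, q) \<noteq> (0, 0)" "(a - l) * p + b * q = 0" "c * p + (d - l) * q = 0" by blast
  then have "(p, q) \<noteq> (0, 0) \<and> a * p + b * q = l * p \<and> c * p + d * q = l * q"
    by (simp add: algebra_simps)
  then show ?thesis by blast
qed

lemma rank_one_factor_2:
  fixes a b c d :: complex
  assumes "(a, b, c, d) \<noteq> (0, 0, 0, 0)" and "a * d = b * c"
  shows "\<exists>x y p q. (x, y) \<noteq> (0, 0) \<and> (p, q) \<noteq> (0, 0) \<and> a = x * p \<and> b = x * q \<and> c = y * p \<and> d = y * q"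
proof -
  consider "a \<noteq> 0" | "a = 0" "b \<noteq> 0" | "a = 0" "b = 0" by blast
  then show ?thesis
  proof cases
    case 1
    then show ?thesis
      using assms by (intro exI[of _ 1] exI[of _ "c / a"] exI[of _ a] exI[of _ b]) (auto simp: field_simps)
  next
    case 2
    then show ?thesis
      using assms by (intro exI[of _ 1] exI[of _ "d / b"] exI[of _ a] exI[of _ b]) (auto simp: field_simps)
  next
    case 3
    then show ?thesis
      using assms by (intro exI[of _ 0] exI[of _ 1] exI[of _ c] exI[of _ d]) auto
  qed
qed

lemma proportional_2:
  fixes x y a b u v :: complex
  assumes "(x, y) \<noteq> (0, 0)" "(u, v) \<noteq> (0, 0)" "x * a + y * b = 0" "x * u + y * v = 0"
  shows "\<exists>c. a = c * u \<and> b = c * v"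
proof -
  have m: "a * v = b * u"
  proof -
    have "x * (a * v - b * u) = 0" "y * (a * v - b * u) = 0" using assms(3,4) by algebra+
    then show ?thesis using assms(1) by auto
  qed
  show ?thesis
  proof (cases "u = 0")
    case True
    then show ?thesis using assms(2) m by (intro exI[of _ "b / v"]) auto
  next
    case False
    then show ?thesis using m by (intro exI[of _ "a / u"]) (auto simp: field_simps)
  qed
qed

text \<open>
  The algebra of lower right 2 by 2 blocks is studied without introducing 2 by 2 matrices: for matrices
  whose first column vanishes below the diagonal, the block of a product is the product of the blocks.
\<close>
definition block_eigenvector :: "M3 set \<Rightarrow> complex \<Rightarrow> complex \<Rightarrow> bool"
  where "block_eigenvector B p q \<longleftrightarrow> (p, q) \<noteq> (0, 0) \<and>
    (\<forall>X\<in>B. \<exists>c. X $ 2 $ 2 * p + X $ 2 $ 3 * q = c * p \<and> X $ 3 $ 2 * p + X $ 3 $ 3 * q = c * q)"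

definition block_zero :: "M3 \<Rightarrow> bool"
  where "block_zero X \<longleftrightarrow> X $ 2 $ 2 = 0 \<and> X $ 2 $ 3 = 0 \<and> X $ 3 $ 2 = 0 \<and> X $ 3 $ 3 = 0"

definition block_det :: "M3 \<Rightarrow> complex"
  where "block_det X = X $ 2 $ 2 * X $ 3 $ 3 - X $ 2 $ 3 * X $ 3 $ 2"

definition stabilizes_e1 :: "M3 set \<Rightarrow> bool"
  where "stabilizes_e1 B \<longleftrightarrow> (\<forall>X\<in>B. X $ 2 $ 1 = 0 \<and> X $ 3 $ 1 = 0)"

text \<open>
  A functional with a rank one coefficient matrix has the form \<open>X \<mapsto> \<alpha> (X v)\<close> on blocks, where \<open>\<alpha>\<close> is a row and
  \<open>v = (p, q)\<close>. If it vanishes on the algebra, then the orbit of \<open>v\<close> lies in the line \<open>ker \<alpha>\<close>. Either the orbit is zero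
  and \<open>v\<close> itself is an eigenvector, or any nonzero vector of the orbit is one.
\<close>
lemma block_eigenvector_if_singular_functional:
  assumes sub: "subalgebra B" and st: "stabilizes_e1 B"
    and k: "(a, b, c, d) \<noteq> (0, 0, 0, 0)" "a * d = b * c"
    and van: "\<And>X. X \<in> B \<Longrightarrow> a * X $ 2 $ 2 + b * X $ 2 $ 3 + c * X $ 3 $ 2 + d * X $ 3 $ 3 = 0"
  shows "\<exists>p q. block_eigenvector B p q"
proof -
  obtain x y p q where xy: "(x, y) \<noteq> (0, 0)" and pq: "(p, q) \<noteq> (0, 0)" and
    fac: "a = x * p" "b = x * q" "c = y * p" "d = y * q"
    using rank_one_factor_2[OF k] by blast
  have xyX: "x * (X $ 2 $ 2 * p + X $ 2 $ 3 * q) + y * (X $ 3 $ 2 * p + X $ 3 $ 3 * q) = 0" if "X \<in> B" for X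
    using van[OF that] by (simp add: fac algebra_simps)
  show ?thesis
  proof (cases "\<forall>X\<in>B. X $ 2 $ 2 * p + X $ 2 $ 3 * q = 0 \<and> X $ 3 $ 2 * p + X $ 3 $ 3 * q = 0")
    case True
    with pq have "block_eigenvector B p q" by (auto simp: block_eigenvector_def intro!: exI[of _ 0])
    then show ?thesis by blast
  next
    case False
    then obtain Y where Y: "Y \<in> B" and
      uv: "(Y $ 2 $ 2 * p + Y $ 2 $ 3 * q, Y $ 3 $ 2 * p + Y $ 3 $ 3 * q) \<noteq> (0, 0)" (is "(?u, ?v) \<noteq> _")
      by auto
    have "\<exists>c. X $ 2 $ 2 * ?u + X $ 2 $ 3 * ?v = c * ?u \<and> X $ 3 $ 2 * ?u + X $ 3 $ 3 * ?v = c * ?v" if "X \<in> B" for X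
    proof (rule proportional_2[OF xy uv])
      have "X ** Y \<in> B" by (rule subalgebraD(4)[OF sub that Y])
      from xyX[OF this] show "x * (X $ 2 $ 2 * ?u + X $ 2 $ 3 * ?v) + y * (X $ 3 $ 2 * ?u + X $ 3 $ 3 * ?v) = 0"
        using st that by (simp add: stabilizes_e1_def matrix_mult_nth algebra_simps)
    qed (rule xyX[OF Y])
    with uv have "block_eigenvector B ?u ?v" by (simp add: block_eigenvector_def)
    then show ?thesis by blast
  qed
qed

text \<open>
  Over the complex numbers \<open>det (X + t Y) = 0\<close> has a solution \<open>t\<close> whenever \<open>det Y \<noteq> 0\<close>. If zero is the
  only singular block, then all blocks are therefore multiples of one block, which has an eigenvector.
\<close>
lemma block_eigenvector_if_nonsingular:
  assumes sub: "subalgebra B"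
    and ns: "\<And>X. X \<in> B \<Longrightarrow> block_det X = 0 \<Longrightarrow> block_zero X"
  shows "\<exists>p q. block_eigenvector B p q"
proof (cases "\<forall>X\<in>B. block_zero X")
  case True
  then have "block_eigenvector B 1 0"
    by (auto simp: block_eigenvector_def block_zero_def)
  then show ?thesis by blast
next
  case False
  then obtain Y where Y: "Y \<in> B" "\<not> block_zero Y" by blast
  then have "block_det Y \<noteq> 0" using ns by blast
  obtain l p q where pq: "(p, q) \<noteq> (0, 0)"
    "Y $ 2 $ 2 * p + Y $ 2 $ 3 * q = l * p" "Y $ 3 $ 2 * p + Y $ 3 $ 3 * q = l * q"
    using eigenvector_2[of "Y $ 2 $ 2" "Y $ 2 $ 3" "Y $ 3 $ 2" "Y $ 3 $ 3"] by blast
  have "\<exists>c. X $ 2 $ 2 * p + X $ 2 $ 3 * q = c * p \<and> X $ 3 $ 2 * p + X $ 3 $ 3 * q = c * q"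
    if "X \<in> B" for X
  proof -
    obtain t where t: "block_det Y * t\<^sup>2 + (X $ 2 $ 2 * Y $ 3 $ 3 + Y $ 2 $ 2 * X $ 3 $ 3
        - X $ 2 $ 3 * Y $ 3 $ 2 - Y $ 2 $ 3 * X $ 3 $ 2) * t + block_det X = 0"
      using quadratic_root[OF \<open>block_det Y \<noteq> 0\<close>] by blast
    have "block_det (X + cscale t Y) = 0"
      using t by (simp add: block_det_def cscale_nth power2_eq_square algebra_simps)
    moreover have "X + cscale t Y \<in> B"
      by (intro subalgebraD[OF sub] that Y)
    ultimately have "block_zero (X + cscale t Y)" by (intro ns)
    then have X: "X $ 2 $ 2 = - (t * Y $ 2 $ 2)" "X $ 2 $ 3 = - (t * Y $ 2 $ 3)"
      "X $ 3 $ 2 = - (t * Y $ 3 $ 2)" "X $ 3 $ 3 = - (t * Y $ 3 $ 3)"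
      by (simp_all add: block_zero_def cscale_nth add_eq_0_iff2)
    have "X $ 2 $ 2 * p + X $ 2 $ 3 * q = - t * (Y $ 2 $ 2 * p + Y $ 2 $ 3 * q)"
      "X $ 3 $ 2 * p + X $ 3 $ 3 * q = - t * (Y $ 3 $ 2 * p + Y $ 3 $ 3 * q)"
      by (simp_all add: X algebra_simps)
    then show ?thesis by (intro exI[of _ "- t * l"]) (simp add: pq)
  qed
  then have "block_eigenvector B p q" using pq(1) by (simp add: block_eigenvector_def)
  then show ?thesis by blast
qed

text \<open>
  This is Burnside's theorem for 2 by 2 blocks. If some block is missing, then a nonzero functional
  \<open>X \<mapsto> \<Sum>i j. k i j * X i j\<close> vanishes on all blocks. If \<open>k\<close> is invertible and the algebra contains a nonzero
  singular block \<open>Y\<close>, then the functional \<open>X \<mapsto> k (Y X)\<close> vanishes too, and its coefficient matrix is the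
  transpose of \<open>Y\<close> times \<open>k\<close>, which is nonzero and singular. So either a functional of rank one vanishes on
  the algebra, or the algebra has no nonzero singular blocks, and both situations were settled above.
\<close>
lemma block_burnside:
  assumes sub: "subalgebra B" and st: "stabilizes_e1 B"
  shows "(\<exists>p q. block_eigenvector B p q) \<or>
    (\<forall>a b c d. \<exists>X\<in>B. X $ 2 $ 2 = a \<and> X $ 2 $ 3 = b \<and> X $ 3 $ 2 = c \<and> X $ 3 $ 3 = d)"
proof (rule disjCI)
  note mem = subalgebraD[OF sub]
  assume "\<not> (\<forall>a b c d. \<exists>X\<in>B. X $ 2 $ 2 = a \<and> X $ 2 $ 3 = b \<and> X $ 3 $ 2 = c \<and> X $ 3 $ 3 = d)"
  then obtain a b c d where
    abcd: "\<And>X. X \<in> B \<Longrightarrow> \<not> (X $ 2 $ 2 = a \<and> X $ 2 $ 3 = b \<and> X $ 3 $ 2 = c \<and> X $ 3 $ 3 = d)"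
    by blast
  \<comment> \<open>Enlarging the algebra by all matrices with zero block makes every functional that vanishes on it depend on the block only.\<close>
  define S where "S = {Z. \<exists>X\<in>B. block_zero (Z - X)}"
  have "M3.subspace S"
  proof (rule M3.subspaceI)
    show "0 \<in> S" unfolding S_def using mem(5) by (auto simp: block_zero_def intro!: bexI[of _ 0])
    fix Z W assume "Z \<in> S" "W \<in> S"
    then obtain X Y where "X \<in> B" "Y \<in> B" "block_zero (Z - X)" "block_zero (W - Y)"
      by (auto simp: S_def)
    then show "Z + W \<in> S" unfolding S_def
      by (intro CollectI bexI[of _ "X + Y"] mem) (simp_all add: block_zero_def)
  next
    fix Z t assume "Z \<in> S"
    then obtain X where "X \<in> B" "block_zero (Z - X)" by (auto simp: S_def)
    then show "cscale t Z \<in> S" unfolding S_def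
      by (intro CollectI bexI[of _ "cscale t X"] mem) (simp_all add: block_zero_def cscale_nth)
  qed
  moreover define u :: M3 where "u = vector [0, vector [0, a, b], vector [0, c, d]]"
  have "u \<notin> S" using abcd by (auto simp: S_def u_def block_zero_def)
  ultimately obtain f where f: "Vector_Spaces.linear cscale (*) f" "\<And>X. X \<in> S \<Longrightarrow> f X = 0" "f u = 1"
    using separating_functional[OF M3.vector_space_axioms] by metis
  have "X \<in> S" if "block_zero X" for X
    unfolding S_def using that mem(5) by (auto intro!: bexI[of _ 0])
  then have f0: "f (e 1 j) = 0" "f (e j 1) = 0" for j
    by (auto intro!: f(2) simp: block_zero_def e_nth)
  define k where "k i j = f (e i j)" for i j
  have fk: "f X = k 2 2 * X $ 2 $ 2 + k 2 3 * X $ 2 $ 3 + k 3 2 * X $ 3 $ 2 + k 3 3 * X $ 3 $ 3" for X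
    by (subst functional_expansion[OF f(1)]) (simp add: sum_3 f0 k_def)
  have van: "k 2 2 * X $ 2 $ 2 + k 2 3 * X $ 2 $ 3 + k 3 2 * X $ 3 $ 2 + k 3 3 * X $ 3 $ 3 = 0" if "X \<in> B" for X
  proof -
    have "X \<in> S" using that by (auto simp: S_def block_zero_def intro!: bexI[of _ X])
    then show ?thesis using f(2) fk by metis
  qed
  have k0: "(k 2 2, k 2 3, k 3 2, k 3 3) \<noteq> (0, 0, 0, 0)" using f(3) fk[of u] by auto
  show "\<exists>p q. block_eigenvector B p q"
  proof (cases "k 2 2 * k 3 3 = k 2 3 * k 3 2")
    case True
    then show ?thesis by (rule block_eigenvector_if_singular_functional[OF sub st k0 _ van])
  next
    case detk: False
    show ?thesis
    proof (cases "\<forall>Y\<in>B. block_det Y = 0 \<longrightarrow> block_zero Y")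
      case True
      then show ?thesis using block_eigenvector_if_nonsingular[OF sub] by blast
    next
      case False
      then obtain Y where Y: "Y \<in> B" "block_det Y = 0" "\<not> block_zero Y" by blast
      define l where "l i j = k 2 j * Y $ 2 $ i + k 3 j * Y $ 3 $ i" for i j
      show ?thesis
      proof (rule block_eigenvector_if_singular_functional[OF sub st, of "l 2 2" "l 2 3" "l 3 2" "l 3 3"])
        have "l 2 2 * l 3 3 - l 2 3 * l 3 2 = (k 2 2 * k 3 3 - k 2 3 * k 3 2) * block_det Y"
          by (simp add: l_def block_det_def algebra_simps)
        then show "l 2 2 * l 3 3 = l 2 3 * l 3 2" using Y(2) by simp
        show "(l 2 2, l 2 3, l 3 2, l 3 3) \<noteq> (0, 0, 0, 0)"
        proof
          assume l: "(l 2 2, l 2 3, l 3 2, l 3 3) = (0, 0, 0, 0)"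
          \<comment> \<open>The block of \<open>Y\<close> is recovered from \<open>l\<close> by the adjugate of \<open>k\<close>.\<close>
          define D where "D = k 2 2 * k 3 3 - k 2 3 * k 3 2"
          have "D * Y $ 2 $ i = k 3 3 * l i 2 - k 3 2 * l i 3" "D * Y $ 3 $ i = k 2 2 * l i 3 - k 2 3 * l i 2" for i
            by (simp_all add: D_def l_def algebra_simps)
          from this[of 2] this[of 3] have "block_zero Y"
            using l detk by (simp add: block_zero_def D_def)
          with Y(3) show False by blast
        qed
        fix X assume "X \<in> B"
        then have "Y ** X \<in> B" using Y by (intro mem)
        from van[OF this] show "l 2 2 * X $ 2 $ 2 + l 2 3 * X $ 2 $ 3 + l 3 2 * X $ 3 $ 2 + l 3 3 * X $ 3 $ 3 = 0"
          using st Y(1) by (simp add: stabilizes_e1_def matrix_mult_nth l_def algebra_simps)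
      qed
    qed
  qed
qed

section \<open>Recognising the normal forms\<close>

definition canonical :: "M3 set set"
  where "canonical =
      {M3.span {e 1 1, e 2 2, e 2 3, e 3 2, e 3 3},
       M3.span {e 1 1, e 1 2, e 1 3, e 2 2, e 3 3},
       M3.span {e 1 1, e 1 2, e 1 3, e 2 3, e 2 2 + e 3 3},
       M3.span {e 1 1, e 1 2, e 1 3, e 2 2, e 2 3},
       M3.span {e 1 1, e 1 2, e 1 3, e 2 3, e 3 3},
       M3.span {e 1 1 + e 3 3, e 1 2, e 1 3, e 2 2, e 2 3}}"

definition classified :: "M3 set \<Rightarrow> bool"
  where "classified B \<longleftrightarrow> (\<exists>C\<in>canonical. equivalent B C)"

lemma classified_equivalent: "equivalent B C \<Longrightarrow> classified C \<Longrightarrow> classified B"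
  unfolding classified_def using equivalent_trans by blast

lemma classified_canonical:
  assumes "B \<in> canonical"
  shows "classified B"
proof -
  have "equivalent B ((\<lambda>X. mat 1 ** X ** mat 1) ` B)"
    by (rule equivalent_conjugate) simp_all
  then show ?thesis using assms by (auto simp: classified_def)
qed

lemma classified_if_subset_span:
  assumes "subalgebra B" "M3.dim B = 5" "B \<subseteq> M3.span {E1, E2, E3, E4, E5}"
    and "M3.span {E1, E2, E3, E4, E5} \<in> canonical"
  shows "classified B"
proof -
  have "card {E1, E2, E3, E4, E5} \<le> 5"
    using card_length[of "[E1, E2, E3, E4, E5]"] by simp
  then have "B = M3.span {E1, E2, E3, E4, E5}"
    using assms by (intro eq_span_of_dim_5) auto
  then show ?thesis using assms(4) by (auto intro: classified_canonical)
qed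

lemma classified_by_conjugation:
  assumes "subalgebra B" "M3.dim B = 5" and PQ: "P ** Q = mat 1" "Q ** P = mat 1"
    and sp: "\<And>X. X \<in> B \<Longrightarrow> Q ** X ** P \<in> M3.span {E1, E2, E3, E4, E5}"
    and "M3.span {E1, E2, E3, E4, E5} \<in> canonical"
  shows "classified B"
proof -
  note eq = equivalent_conjugate[OF PQ, of B]
  show ?thesis
    by (rule classified_equivalent[OF eq], rule classified_if_subset_span[where ?E1.0 = E1 and ?E2.0 = E2 and ?E3.0 = E3 and ?E4.0 = E4 and ?E5.0 = E5])
      (use assms equivalent_subalgebra[OF eq] equivalent_dim[OF eq] in auto)
qed

section \<open>Algebras with full lower right block\<close>

text \<open>
  Four elements of the algebra realise the unit blocks, so the fifth dimension provides a nonzero element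
  \<open>k\<close> with zero block, that is, a first row \<open>(a, r)\<close>. If \<open>a\<close> were zero, right multiplication by
  the full block would turn \<open>r\<close> into every row, and the dimension would be at least 6. Hence \<open>k\<close> may be scaled to
  \<open>(1, r)\<close>. For \<open>X\<close> in the algebra the element \<open>k X - X 1 1 k\<close> has zero block and zero corner, so it vanishes;
  this expresses the rest of the first row of \<open>X\<close> in terms of \<open>r\<close>, and one unipotent conjugation clears it.
\<close>
lemma classified_if_block_full:
  assumes sub: "subalgebra B" and dim: "M3.dim B = 5" and st: "stabilizes_e1 B"
    and full: "\<And>a b c d. \<exists>X\<in>B. X $ 2 $ 2 = a \<and> X $ 2 $ 3 = b \<and> X $ 3 $ 2 = c \<and> X $ 3 $ 3 = d"
  shows "classified B"
proof -
  note mem = subalgebraD[OF sub]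
  have st1: "X $ 2 $ 1 = 0" "X $ 3 $ 1 = 0" if "X \<in> B" for X
    using st that by (auto simp: stabilizes_e1_def)
  obtain Y22 where Y22: "Y22 \<in> B" "Y22 $ 2 $ 2 = 1" "Y22 $ 2 $ 3 = 0" "Y22 $ 3 $ 2 = 0" "Y22 $ 3 $ 3 = 0"
    using full by blast
  obtain Y23 where Y23: "Y23 \<in> B" "Y23 $ 2 $ 2 = 0" "Y23 $ 2 $ 3 = 1" "Y23 $ 3 $ 2 = 0" "Y23 $ 3 $ 3 = 0"
    using full by blast
  obtain Y32 where Y32: "Y32 \<in> B" "Y32 $ 2 $ 2 = 0" "Y32 $ 2 $ 3 = 0" "Y32 $ 3 $ 2 = 1" "Y32 $ 3 $ 3 = 0"
    using full by blast
  obtain Y33 where Y33: "Y33 \<in> B" "Y33 $ 2 $ 2 = 0" "Y33 $ 2 $ 3 = 0" "Y33 $ 3 $ 2 = 0" "Y33 $ 3 $ 3 = 1"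
    using full by blast
  note Y = Y22 Y23 Y32 Y33

  have not_both: "\<not> (e 1 2 \<in> B \<and> e 1 3 \<in> B)"
  proof
    assume e: "e 1 2 \<in> B \<and> e 1 3 \<in> B"
    let ?y = "\<lambda>n. [e 1 2, e 1 3, Y22, Y23, Y32, Y33] ! n"
    have "card {..<6::nat} \<le> M3.dim B"
    proof (rule dim_lower_bound[where y = ?y])
      show "?y i \<in> B" if "i \<in> {..<6}" for i
        using that e Y by (auto simp: numeral_eq_Suc less_Suc_eq)
      fix c and i :: nat
      assume sum0: "(\<Sum>i<6. cscale (c i) (?y i)) = 0" and i: "i \<in> {..<6}"
      have comp: "(\<Sum>i<6. cscale (c i) (?y i)) $ k $ l = 0" for k l
        by (simp only: sum0 zero_index)
      have c: "c 2 = 0" "c 3 = 0" "c 4 = 0" "c 5 = 0"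
        using comp[of 2 2] comp[of 2 3] comp[of 3 2] comp[of 3 3]
        by (simp_all add: numeral_eq_Suc nth_simps Y)
      have "c 0 = 0" "c 1 = 0"
        using comp[of 1 2] comp[of 1 3] c
        by (simp_all add: numeral_eq_Suc nth_simps Y)
      with c i show "c i = 0" by (auto simp: numeral_eq_Suc less_Suc_eq)
    qed simp
    then show False using dim by simp
  qed

  have row_zero: "X = 0" if X: "X \<in> B" "block_zero X" "X $ 1 $ 1 = 0" for X
  proof (rule ccontr)
    assume "X \<noteq> 0"
    then have "X $ 1 $ 2 \<noteq> 0 \<or> X $ 1 $ 3 \<noteq> 0"
      using X st1[OF X(1)] by (auto simp: M3_eq_iff forall_3 block_zero_def)
    moreover have "e 1 2 \<in> B \<and> e 1 3 \<in> B" if "X $ 1 $ 2 \<noteq> 0"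
    proof
      have "e 1 2 = cscale (1 / X $ 1 $ 2) (X ** Y22)" "e 1 3 = cscale (1 / X $ 1 $ 2) (X ** Y23)"
        using X st1 that Y by (auto simp: M3_eq_iff forall_3 block_zero_def nth_simps)
      then show "e 1 2 \<in> B" "e 1 3 \<in> B" using X Y by (auto intro!: mem)
    qed
    moreover have "e 1 2 \<in> B \<and> e 1 3 \<in> B" if "X $ 1 $ 3 \<noteq> 0"
    proof
      have "e 1 2 = cscale (1 / X $ 1 $ 3) (X ** Y32)" "e 1 3 = cscale (1 / X $ 1 $ 3) (X ** Y33)"
        using X st1 that Y by (auto simp: M3_eq_iff forall_3 block_zero_def nth_simps)
      then show "e 1 2 \<in> B" "e 1 3 \<in> B" using X Y by (auto intro!: mem)
    qed
    ultimately show False using not_both by blast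
  qed

  have "\<exists>X\<in>B. \<forall>c. X \<noteq> (\<Sum>i<4. cscale (c i) ([Y22, Y23, Y32, Y33] ! i))"
    using dim_upper_bound[of "{..<4::nat}" B "\<lambda>i. [Y22, Y23, Y32, Y33] ! i"] dim by force
  then obtain X0 where X0: "X0 \<in> B" "\<And>c. X0 \<noteq> (\<Sum>i<4. cscale (c i) ([Y22, Y23, Y32, Y33] ! i))"
    by blast
  define k0 where "k0 = X0 - (cscale (X0 $ 2 $ 2) Y22 + cscale (X0 $ 2 $ 3) Y23
    + cscale (X0 $ 3 $ 2) Y32 + cscale (X0 $ 3 $ 3) Y33)"
  have k0: "k0 \<in> B" unfolding k0_def by (intro mem X0 Y)
  have "k0 \<noteq> 0"
    using X0(2)[of "\<lambda>i. [X0 $ 2 $ 2, X0 $ 2 $ 3, X0 $ 3 $ 2, X0 $ 3 $ 3] ! i"]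
    by (simp add: k0_def numeral_eq_Suc)
  have "block_zero k0" by (simp add: k0_def block_zero_def nth_simps Y)
  then have "k0 $ 1 $ 1 \<noteq> 0" using row_zero k0 \<open>k0 \<noteq> 0\<close> by blast
  \<comment> \<open>Normalised so that \<open>k\<close> acts as a left identity on the corner entry.\<close>
  define k where "k = cscale (1 / k0 $ 1 $ 1) k0"
  have k: "k \<in> B" "block_zero k" "k $ 1 $ 1 = 1"
    using k0 \<open>block_zero k0\<close> \<open>k0 $ 1 $ 1 \<noteq> 0\<close>
    by (auto simp: k_def nth_simps block_zero_def intro: mem)
  have row: "X $ 1 $ 2 = X $ 1 $ 1 * k $ 1 $ 2 - k $ 1 $ 2 * X $ 2 $ 2 - k $ 1 $ 3 * X $ 3 $ 2"
    "X $ 1 $ 3 = X $ 1 $ 1 * k $ 1 $ 3 - k $ 1 $ 2 * X $ 2 $ 3 - k $ 1 $ 3 * X $ 3 $ 3" if X: "X \<in> B" for X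
  proof -
    have "k ** X - cscale (X $ 1 $ 1) k = 0"
    proof (rule row_zero)
      show "k ** X - cscale (X $ 1 $ 1) k \<in> B" by (intro mem k X)
    qed (use k st1[OF X] st1[OF k(1)] in \<open>simp_all add: block_zero_def nth_simps\<close>)
    then have "(k ** X - cscale (X $ 1 $ 1) k) $ 1 $ j = 0" for j by simp
    from this[of 2] this[of 3] show
      "X $ 1 $ 2 = X $ 1 $ 1 * k $ 1 $ 2 - k $ 1 $ 2 * X $ 2 $ 2 - k $ 1 $ 3 * X $ 3 $ 2"
      "X $ 1 $ 3 = X $ 1 $ 1 * k $ 1 $ 3 - k $ 1 $ 2 * X $ 2 $ 3 - k $ 1 $ 3 * X $ 3 $ 3"
      using k by (simp_all add: nth_simps algebra_simps)
  qed
  let ?P = "vector [vector [1, - k $ 1 $ 2, - k $ 1 $ 3], vector [0, 1, 0], vector [0, 0, 1]] :: M3"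
  let ?Q = "vector [vector [1, k $ 1 $ 2, k $ 1 $ 3], vector [0, 1, 0], vector [0, 0, 1]] :: M3"
  show ?thesis
  proof (rule classified_by_conjugation[OF sub dim, of ?P ?Q])
    fix X assume X: "X \<in> B"
    show "?Q ** X ** ?P \<in> M3.span {e 1 1, e 2 2, e 2 3, e 3 2, e 3 3}"
      by (rule five_term_sum_in_span[of _ "X $ 1 $ 1" _ "X $ 2 $ 2" _ "X $ 2 $ 3" _ "X $ 3 $ 2" _ "X $ 3 $ 3"])
         (simp add: M3_eq_iff forall_3 nth_simps st1[OF X] row[OF X] algebra_simps)
  qed (simp_all add: M3_eq_iff forall_3 nth_simps canonical_def)
qed

section \<open>Upper triangular algebras\<close>

definition upper_triangular :: "M3 \<Rightarrow> bool"
  where "upper_triangular X \<longleftrightarrow> X $ 2 $ 1 = 0 \<and> X $ 3 $ 1 = 0 \<and> X $ 3 $ 2 = 0"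

text \<open>
  The change of basis fixes the first basis vector and sends the second one to the eigenvector of the blocks;
  the third one is any standard vector completing the basis.
\<close>
lemma equivalent_upper_triangular:
  assumes st: "stabilizes_e1 B" and ev: "block_eigenvector B p q"
  obtains C where "equivalent B C" and "\<And>X. X \<in> C \<Longrightarrow> upper_triangular X"
proof -
  have pq: "p \<noteq> 0 \<or> q \<noteq> 0" using ev by (auto simp: block_eigenvector_def)
  define P :: M3 where "P = (if p \<noteq> 0 then vector [vector [1, 0, 0], vector [0, p, 0], vector [0, q, 1]]
    else vector [vector [1, 0, 0], vector [0, 0, 1], vector [0, q, 0]])"
  define Q :: M3 where "Q = (if p \<noteq> 0 then vector [vector [1, 0, 0], vector [0, 1 / p, 0], vector [0, - q / p, 1]]
    else vector [vector [1, 0, 0], vector [0, 0, 1 / q], vector [0, 1, 0]])"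
  have PQ: "P ** Q = mat 1" "Q ** P = mat 1"
    using pq by (auto simp: P_def Q_def M3_eq_iff forall_3 nth_simps)
  have "upper_triangular (Q ** X ** P)" if X: "X \<in> B" for X
  proof -
    obtain c where c: "X $ 2 $ 2 * p + X $ 2 $ 3 * q = c * p" "X $ 3 $ 2 * p + X $ 3 $ 3 * q = c * q"
      using ev X by (auto simp: block_eigenvector_def)
    have st1: "X $ 2 $ 1 = 0" "X $ 3 $ 1 = 0" using st X by (auto simp: stabilizes_e1_def)
    show ?thesis
    proof (cases "p = 0")
      case True
      with c pq st1 show ?thesis by (simp add: upper_triangular_def P_def Q_def nth_simps)
    next
      case False
      have "(Q ** X ** P) $ 3 $ 2 = (X $ 3 $ 2 * p + X $ 3 $ 3 * q) - q / p * (X $ 2 $ 2 * p + X $ 2 $ 3 * q)"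
        using False by (simp add: P_def Q_def nth_simps algebra_simps)
      also have "\<dots> = 0" using False by (simp add: c)
      finally show ?thesis
        using False st1 by (simp add: upper_triangular_def P_def Q_def nth_simps)
    qed
  qed
  then show thesis using equivalent_conjugate[OF PQ, of B] that by blast
qed

text \<open>
  Upper triangular matrices have dimension 6, so a 5-dimensional subspace is the kernel of one functional,
  whose coefficients are \<open>c\<close>. It is the direction from the equation to membership in the
  algebra that later provides elements to multiply.
\<close>
lemma triangular_hyperplane:
  assumes sub: "subalgebra B" and dim: "M3.dim B = 5"
    and tri: "\<And>X. X \<in> B \<Longrightarrow> upper_triangular X"
  obtains c :: "3 \<Rightarrow> 3 \<Rightarrow> complex"
  where "(c 1 1, c 1 2, c 1 3, c 2 2, c 2 3, c 3 3) \<noteq> (0, 0, 0, 0, 0, 0)"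
    and "\<And>X. X \<in> B \<longleftrightarrow> upper_triangular X \<and> c 1 1 * X $ 1 $ 1 + c 1 2 * X $ 1 $ 2 + c 1 3 * X $ 1 $ 3
      + c 2 2 * X $ 2 $ 2 + c 2 3 * X $ 2 $ 3 + c 3 3 * X $ 3 $ 3 = 0"
proof -
  let ?y = "\<lambda>n. [e 1 1, e 1 2, e 1 3, e 2 2, e 2 3, e 3 3] ! n"
  have yB: "\<exists>n<6. ?y n \<notin> B"
  proof (rule ccontr)
    assume B: "\<not> (\<exists>n<6. ?y n \<notin> B)"
    have "card {..<6::nat} \<le> M3.dim B"
    proof (rule dim_lower_bound[where y = ?y])
      show "?y i \<in> B" if "i \<in> {..<6}" for i
        using that B by simp
      fix c and i :: nat
      assume sum0: "(\<Sum>i<6. cscale (c i) (?y i)) = 0" and i: "i \<in> {..<6}"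
      have comp: "(\<Sum>i<6. cscale (c i) (?y i)) $ k $ l = 0" for k l
        by (simp only: sum0 zero_index)
      have "c 0 = 0" "c 1 = 0" "c 2 = 0" "c 3 = 0" "c 4 = 0" "c 5 = 0"
        using comp[of 1 1] comp[of 1 2] comp[of 1 3] comp[of 2 2] comp[of 2 3] comp[of 3 3]
        by (simp_all add: numeral_eq_Suc nth_simps)
      with i show "c i = 0" by (auto simp: numeral_eq_Suc less_Suc_eq)
    qed simp
    then show False using dim by simp
  qed
  then obtain n where n: "n < 6" "?y n \<notin> B" by blast
  define u where "u = ?y n"
  have u: "u \<notin> B" "upper_triangular u"
    using n by (auto simp: u_def upper_triangular_def numeral_eq_Suc less_Suc_eq e_nth)
  have "M3.subspace B" using sub by (simp add: subalgebra_def)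
  from separating_functional[OF M3.vector_space_axioms this u(1)]
  obtain f where f: "Vector_Spaces.linear cscale (*) f" "\<And>X. X \<in> B \<Longrightarrow> f X = 0" "f u = 1"
    by metis
  interpret f: Vector_Spaces.linear cscale "(*)" f by fact
  define c where "c i j = f (e i j)" for i j
  have fX: "f X = c 1 1 * X $ 1 $ 1 + c 1 2 * X $ 1 $ 2 + c 1 3 * X $ 1 $ 3
      + c 2 2 * X $ 2 $ 2 + c 2 3 * X $ 2 $ 3 + c 3 3 * X $ 3 $ 3" if "upper_triangular X" for X
    using that functional_expansion[OF f(1), of X] by (simp add: sum_3 upper_triangular_def c_def)
  define H where "H = {X. upper_triangular X \<and> f X = 0}"
  have H: "M3.subspace H"
    by (rule M3.subspaceI) (auto simp: H_def upper_triangular_def nth_simps f.add f.scale f.zero)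
  have "M3.dim (insert u H) \<le> card {..<6::nat}"
  proof (rule dim_upper_bound[where y = ?y])
    fix X assume "X \<in> insert u H"
    then have "upper_triangular X" using u by (auto simp: H_def)
    then show "\<exists>c. X = (\<Sum>i<6. cscale (c i) (?y i))"
      by (intro exI[of _ "\<lambda>i. [X $ 1 $ 1, X $ 1 $ 2, X $ 1 $ 3, X $ 2 $ 2, X $ 2 $ 3, X $ 3 $ 3] ! i"])
         (simp add: M3_eq_iff forall_3 numeral_eq_Suc nth_simps upper_triangular_def)
  qed simp
  moreover have "u \<notin> H" using f(3) by (simp add: H_def)
  then have "u \<notin> M3.span H" using M3.span_eq_iff[THEN iffD2, OF H] by metis
  ultimately have "M3.dim H \<le> 5" by (simp add: M3.dim_insert)
  have "B = H"
    by (rule M3.subspace_dim_equal)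
       (use \<open>M3.dim H \<le> 5\<close> dim H f tri \<open>M3.subspace B\<close> in \<open>auto simp: H_def\<close>)
  then have iff: "X \<in> B \<longleftrightarrow> upper_triangular X \<and> c 1 1 * X $ 1 $ 1 + c 1 2 * X $ 1 $ 2 + c 1 3 * X $ 1 $ 3
      + c 2 2 * X $ 2 $ 2 + c 2 3 * X $ 2 $ 3 + c 3 3 * X $ 3 $ 3 = 0" for X
    using fX by (auto simp: H_def)
  have nz: "(c 1 1, c 1 2, c 1 3, c 2 2, c 2 3, c 3 3) \<noteq> (0, 0, 0, 0, 0, 0)"
    using fX[OF u(2)] f(3) by auto
  show thesis by (rule that[OF nz iff])
qed

definition exchange :: M3
  where "exchange = vector [vector [0, 0, 1], vector [0, 1, 0], vector [1, 0, 0]]"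

text \<open>
  Reflection in the secondary diagonal: an antiautomorphism that preserves upper triangular matrices. It
  exchanges the diagonal entries 11 and 33 and the superdiagonal entries 12 and 23, which identifies
  the corresponding linear equations in pairs.
\<close>
definition flip :: "M3 \<Rightarrow> M3"
  where "flip X = exchange ** transpose X ** exchange"

lemma flip_nth:
  "flip X $ 1 $ 1 = X $ 3 $ 3" "flip X $ 1 $ 2 = X $ 2 $ 3" "flip X $ 1 $ 3 = X $ 1 $ 3"
  "flip X $ 2 $ 1 = X $ 3 $ 2" "flip X $ 2 $ 2 = X $ 2 $ 2" "flip X $ 2 $ 3 = X $ 1 $ 2"
  "flip X $ 3 $ 1 = X $ 3 $ 1" "flip X $ 3 $ 2 = X $ 2 $ 1" "flip X $ 3 $ 3 = X $ 1 $ 1"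
  by (simp_all add: flip_def exchange_def nth_simps)

lemma equivalent_flip: "equivalent B (flip ` B)"
proof -
  have "exchange ** exchange = mat 1"
    by (simp add: M3_eq_iff forall_3 exchange_def nth_simps)
  then have "equivalent (transpose ` B) ((\<lambda>X. exchange ** X ** exchange) ` transpose ` B)"
    by (intro equivalent_conjugate)
  from equivalent_trans[OF equivalent_transpose this] show ?thesis
    by (simp add: image_image flip_def)
qed

context
  fixes B :: "M3 set"
  assumes sub: "subalgebra B" and dim: "M3.dim B = 5"
    and tri: "\<And>X. X \<in> B \<Longrightarrow> upper_triangular X"
begin

lemma classified_if_diagonal_relation:
  assumes "(\<forall>X\<in>B. X $ 2 $ 2 = X $ 3 $ 3) \<or> (\<forall>X\<in>B. X $ 3 $ 3 = 0) \<or> (\<forall>X\<in>B. X $ 2 $ 2 = 0) \<or>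
    (\<forall>X\<in>B. X $ 1 $ 1 = X $ 3 $ 3)"
  shows "classified B"
proof -
  have st: "X $ 2 $ 1 = 0" "X $ 3 $ 1 = 0" "X $ 3 $ 2 = 0" if "X \<in> B" for X
    using tri[OF that] by (auto simp: upper_triangular_def)
  from assms consider "\<And>X. X \<in> B \<Longrightarrow> X $ 2 $ 2 = X $ 3 $ 3" | "\<And>X. X \<in> B \<Longrightarrow> X $ 3 $ 3 = 0"
    | "\<And>X. X \<in> B \<Longrightarrow> X $ 2 $ 2 = 0" | "\<And>X. X \<in> B \<Longrightarrow> X $ 1 $ 1 = X $ 3 $ 3" by blast
  then show ?thesis
  proof cases
    case 1
    have "B \<subseteq> M3.span {e 1 1, e 1 2, e 1 3, e 2 3, e 2 2 + e 3 3}"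
    proof
      fix X assume "X \<in> B"
      with 1 st show "X \<in> M3.span {e 1 1, e 1 2, e 1 3, e 2 3, e 2 2 + e 3 3}"
        by (intro five_term_sum_in_span[of _ "X $ 1 $ 1" _ "X $ 1 $ 2" _ "X $ 1 $ 3" _ "X $ 2 $ 3" _ "X $ 3 $ 3"])
           (simp add: M3_eq_iff forall_3 nth_simps)
    qed
    from classified_if_subset_span[OF sub dim this] show ?thesis by (simp add: canonical_def)
  next
    case 2
    have "B \<subseteq> M3.span {e 1 1, e 1 2, e 1 3, e 2 2, e 2 3}"
    proof
      fix X assume "X \<in> B"
      with 2 st show "X \<in> M3.span {e 1 1, e 1 2, e 1 3, e 2 2, e 2 3}"
        by (intro five_term_sum_in_span[of _ "X $ 1 $ 1" _ "X $ 1 $ 2" _ "X $ 1 $ 3" _ "X $ 2 $ 2" _ "X $ 2 $ 3"])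
           (simp add: M3_eq_iff forall_3 nth_simps)
    qed
    from classified_if_subset_span[OF sub dim this] show ?thesis by (simp add: canonical_def)
  next
    case 3
    have "B \<subseteq> M3.span {e 1 1, e 1 2, e 1 3, e 2 3, e 3 3}"
    proof
      fix X assume "X \<in> B"
      with 3 st show "X \<in> M3.span {e 1 1, e 1 2, e 1 3, e 2 3, e 3 3}"
        by (intro five_term_sum_in_span[of _ "X $ 1 $ 1" _ "X $ 1 $ 2" _ "X $ 1 $ 3" _ "X $ 2 $ 3" _ "X $ 3 $ 3"])
           (simp add: M3_eq_iff forall_3 nth_simps)
    qed
    from classified_if_subset_span[OF sub dim this] show ?thesis by (simp add: canonical_def)
  next
    case 4
    have "B \<subseteq> M3.span {e 1 1 + e 3 3, e 1 2, e 1 3, e 2 2, e 2 3}"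
    proof
      fix X assume "X \<in> B"
      with 4 st show "X \<in> M3.span {e 1 1 + e 3 3, e 1 2, e 1 3, e 2 2, e 2 3}"
        by (intro five_term_sum_in_span[of _ "X $ 3 $ 3" _ "X $ 1 $ 2" _ "X $ 1 $ 3" _ "X $ 2 $ 2" _ "X $ 2 $ 3"])
           (simp add: M3_eq_iff forall_3 nth_simps)
    qed
    from classified_if_subset_span[OF sub dim this] show ?thesis by (simp add: canonical_def)
  qed
qed

text \<open>
  Conjugation by \<open>1 + s e 2 3\<close> turns the relation into the vanishing of the entry 23.
\<close>
lemma classified_if_superdiagonal_relation:
  assumes rel: "\<And>X. X \<in> B \<Longrightarrow> X $ 2 $ 3 = s * (X $ 3 $ 3 - X $ 2 $ 2)"
  shows "classified B"
proof -
  let ?P = "vector [vector [1, 0, 0], vector [0, 1, s], vector [0, 0, 1]] :: M3"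
  let ?Q = "vector [vector [1, 0, 0], vector [0, 1, - s], vector [0, 0, 1]] :: M3"
  show ?thesis
  proof (rule classified_by_conjugation[OF sub dim, of ?P ?Q])
    fix X assume X: "X \<in> B"
    then have st: "X $ 2 $ 1 = 0" "X $ 3 $ 1 = 0" "X $ 3 $ 2 = 0"
      using tri[OF X] by (auto simp: upper_triangular_def)
    show "?Q ** X ** ?P \<in> M3.span {e 1 1, e 1 2, e 1 3, e 2 2, e 3 3}"
      by (rule five_term_sum_in_span[of _ "X $ 1 $ 1" _ "X $ 1 $ 2" _ "s * X $ 1 $ 2 + X $ 1 $ 3" _ "X $ 2 $ 2" _ "X $ 3 $ 3"])
         (simp add: M3_eq_iff forall_3 nth_simps st rel[OF X] algebra_simps)
  qed (simp_all add: M3_eq_iff forall_3 nth_simps canonical_def)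
qed

end

text \<open>
  Multiplying suitable elements of the hyperplane restricts its equation \<open>c\<close>. If \<open>c 1 3\<close> were nonzero, the
  hyperplane would contain \<open>e 1 2\<close> and \<open>e 2 3\<close> up to multiples of \<open>e 1 3\<close>, hence also their product \<open>e 1 3\<close>, which is absurd.

  If \<open>c 1 2\<close> is nonzero, the diagonal units and \<open>e 2 3\<close>, corrected by multiples of \<open>e 1 2\<close>, lie in the hyperplane, and
  their products force the equation to be \<open>X 1 2 = s (X 1 1 - X 2 2)\<close>. The case of nonzero \<open>c 2 3\<close> is its mirror image.

  Otherwise the equation involves the diagonal only, and it cuts out a plane in the algebra of triples
  with componentwise product. Writing one coordinate as a combination of the others, closure under
  squares and products forces the coefficients to be 0 or 1 with at most one of them nonzero, so the
  equation says that a coordinate vanishes or that two coordinates agree.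
\<close>
lemma classified_if_upper_triangular:
  assumes sub: "subalgebra B" and dim: "M3.dim B = 5"
    and tri: "\<And>X. X \<in> B \<Longrightarrow> upper_triangular X"
  shows "classified B"
proof -
  have sub': "subalgebra (flip ` B)" and dim': "M3.dim (flip ` B) = 5"
    using equivalent_subalgebra[OF equivalent_flip sub] equivalent_dim[OF equivalent_flip, of B] dim by auto
  have tri': "upper_triangular X" if "X \<in> flip ` B" for X
    using that tri by (auto simp: upper_triangular_def flip_nth)
  obtain c :: "3 \<Rightarrow> 3 \<Rightarrow> complex" where nz: "(c 1 1, c 1 2, c 1 3, c 2 2, c 2 3, c 3 3) \<noteq> (0, 0, 0, 0, 0, 0)"
    and B: "\<And>X. X \<in> B \<longleftrightarrow> upper_triangular X \<and> c 1 1 * X $ 1 $ 1 + c 1 2 * X $ 1 $ 2 + c 1 3 * X $ 1 $ 3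
      + c 2 2 * X $ 2 $ 2 + c 2 3 * X $ 2 $ 3 + c 3 3 * X $ 3 $ 3 = 0"
    by (rule triangular_hyperplane[OF sub dim tri]) (assumption | rule that)+
  \<comment> \<open>Upper triangular matrices by their entries 11, 12, 13, 22, 23 and 33.\<close>
  define T where "T a b d f g h = (vector [vector [a, b, d], vector [0, f, g], vector [0, 0, h]] :: M3)" for a b d f g h
  have T_in: "T a b d f g h \<in> B \<longleftrightarrow> c 1 1 * a + c 1 2 * b + c 1 3 * d + c 2 2 * f + c 2 3 * g + c 3 3 * h = 0"
    for a b d f g h
    unfolding B T_def upper_triangular_def by simp
  have T_mult: "T a b d f g h ** T a' b' d' f' g' h' =
      T (a * a') (a * b' + b * f') (a * d' + b * g' + d * h') (f * f') (f * g' + g * h') (h * h')"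
    for a b d f g h a' b' d' f' g' h'
    by (simp add: T_def M3_eq_iff forall_3 nth_simps)
  have closed: "X \<in> B \<Longrightarrow> Y \<in> B \<Longrightarrow> X ** Y \<in> B" for X Y
    by (rule subalgebraD[OF sub])
  have c13: "c 1 3 = 0"
  proof (rule ccontr)
    assume "c 1 3 \<noteq> 0"
    then have "T 0 1 (- c 1 2 / c 1 3) 0 0 0 \<in> B" "T 0 0 (- c 2 3 / c 1 3) 0 1 0 \<in> B"
      by (simp_all add: T_in)
    from closed[OF this] \<open>c 1 3 \<noteq> 0\<close> show False by (simp add: T_mult T_in)
  qed
  consider "c 1 2 \<noteq> 0" | "c 1 2 = 0" "c 2 3 \<noteq> 0" | "c 1 2 = 0" "c 2 3 = 0" by blast
  then show ?thesis
  proof cases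
    case 1
    define s where "s = c 2 2 / c 1 2"
    define r where "r = c 1 1 / c 1 2"
    define t where "t = c 3 3 / c 1 2"
    have E: "T 0 (- s) 0 1 0 0 \<in> B" "T 1 (- r) 0 0 0 0 \<in> B" "T 0 (- t) 0 0 0 1 \<in> B"
        "T 0 (- (c 2 3 / c 1 2)) 0 0 1 0 \<in> B"
      using 1 by (simp_all add: T_in s_def r_def t_def)
    have c23: "c 2 3 = 0"
      using closed[OF E(1) E(4)] 1 by (simp add: T_mult T_in c13)
    have rs: "r = - s"
      using closed[OF E(2) E(1)] 1 by (simp add: T_mult T_in add_eq_0_iff)
    have t: "t = 0"
      using closed[OF E(3) E(1)] 1 by (simp add: T_mult T_in)
    have "X $ 1 $ 2 = s * (X $ 1 $ 1 - X $ 2 $ 2)" if "X \<in> B" for X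
    proof -
      have "c 1 1 * X $ 1 $ 1 + c 1 2 * X $ 1 $ 2 + c 2 2 * X $ 2 $ 2 + c 3 3 * X $ 3 $ 3 = 0"
        using that B by (simp add: c13 c23)
      moreover have "c 2 2 = c 1 2 * s" "c 1 1 = c 1 2 * - s" "c 3 3 = 0"
        using 1 rs t by (auto simp: s_def r_def t_def field_simps)
      ultimately have "c 1 2 * (X $ 1 $ 2 - s * (X $ 1 $ 1 - X $ 2 $ 2)) = 0"
        by (simp add: algebra_simps)
      then show ?thesis using 1 by simp
    qed
    then have "classified (flip ` B)"
      by (intro classified_if_superdiagonal_relation[OF sub' dim' tri', of s]) (auto simp: flip_nth)
    then show ?thesis by (rule classified_equivalent[OF equivalent_flip])
  next
    case 2
    define s where "s = c 2 2 / c 2 3"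
    define r where "r = c 1 1 / c 2 3"
    define t where "t = c 3 3 / c 2 3"
    have E: "T 0 0 0 1 (- s) 0 \<in> B" "T 1 0 0 0 (- r) 0 \<in> B" "T 0 0 0 0 (- t) 1 \<in> B"
      using 2 by (simp_all add: T_in s_def r_def t_def)
    have ts: "t = - s"
      using closed[OF E(1) E(3)] 2 by (auto simp: T_mult T_in add_eq_0_iff)
    have r: "r = 0"
      using closed[OF E(1) E(2)] 2 by (simp add: T_mult T_in)
    have "X $ 2 $ 3 = s * (X $ 3 $ 3 - X $ 2 $ 2)" if "X \<in> B" for X
    proof -
      have "c 1 1 * X $ 1 $ 1 + c 2 2 * X $ 2 $ 2 + c 2 3 * X $ 2 $ 3 + c 3 3 * X $ 3 $ 3 = 0"
        using that B by (simp add: c13 2)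
      moreover have "c 2 2 = c 2 3 * s" "c 3 3 = c 2 3 * - s" "c 1 1 = 0"
        using 2 r ts by (auto simp: s_def r_def t_def field_simps)
      ultimately have "c 2 3 * (X $ 2 $ 3 - s * (X $ 3 $ 3 - X $ 2 $ 2)) = 0"
        by (simp add: algebra_simps)
      then show ?thesis using 2 by simp
    qed
    then show ?thesis by (intro classified_if_superdiagonal_relation[OF sub dim tri])
  next
    case 3
    have rel: "c 1 1 * X $ 1 $ 1 + c 2 2 * X $ 2 $ 2 + c 3 3 * X $ 3 $ 3 = 0" if "X \<in> B" for X
      using that B by (simp add: c13 3)
    have diag: "(\<forall>X\<in>B. X $ 1 $ 1 = 0) \<or> (\<forall>X\<in>B. X $ 1 $ 1 = X $ 2 $ 2) \<or> (\<forall>X\<in>B. X $ 1 $ 1 = X $ 3 $ 3) \<or>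
      (\<forall>X\<in>B. X $ 2 $ 2 = 0) \<or> (\<forall>X\<in>B. X $ 2 $ 2 = X $ 3 $ 3) \<or> (\<forall>X\<in>B. X $ 3 $ 3 = 0)"
    proof (cases "c 1 1 = 0")
      case False
      define p where "p = - c 2 2 / c 1 1"
      define q where "q = - c 3 3 / c 1 1"
      have E: "T p 0 0 1 0 0 \<in> B" "T q 0 0 0 0 1 \<in> B"
        using False by (simp_all add: T_in p_def q_def)
      have cc: "c 2 2 = - p * c 1 1" "c 3 3 = - q * c 1 1" using False by (simp_all add: p_def q_def)
      \<comment> \<open>The diagonals \<open>(p, 1, 0)\<close> and \<open>(q, 0, 1)\<close> span the plane \<open>x = p y + q z\<close>, so their squares and their product satisfy its equation.\<close>
      have "p * p = p" "q * q = q" "p * q = 0"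
        using closed[OF E(1) E(1)] closed[OF E(2) E(2)] closed[OF E(1) E(2)] False
        by (auto simp: T_mult T_in cc algebra_simps)
      then have pq: "p = 0 \<and> q = 0 \<or> p = 1 \<and> q = 0 \<or> p = 0 \<and> q = 1" by auto
      have "X $ 1 $ 1 = p * X $ 2 $ 2 + q * X $ 3 $ 3" if "X \<in> B" for X
      proof -
        have "c 1 1 * (X $ 1 $ 1 - (p * X $ 2 $ 2 + q * X $ 3 $ 3)) = 0"
          using rel[OF that] by (simp add: cc algebra_simps)
        then show ?thesis using False by simp
      qed
      with pq show ?thesis by auto
    next
      case c11: True
      show ?thesis
      proof (cases "c 2 2 = 0")
        case True
        then show ?thesis using rel nz c11 c13 3 by auto
      next
        case False
        define q where "q = - c 3 3 / c 2 2"
        have E: "T 0 0 0 q 0 1 \<in> B" using False by (simp add: T_in q_def c11)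
        have cc: "c 3 3 = - q * c 2 2" using False by (simp add: q_def)
        have "q * q = q"
          using closed[OF E E] False by (auto simp: T_mult T_in cc c11 algebra_simps)
        then have q: "q = 0 \<or> q = 1" by auto
        have "X $ 2 $ 2 = q * X $ 3 $ 3" if "X \<in> B" for X
        proof -
          have "c 2 2 * (X $ 2 $ 2 - q * X $ 3 $ 3) = 0"
            using rel[OF that] by (simp add: cc c11 algebra_simps)
          then show ?thesis using False by simp
        qed
        with q show ?thesis by auto
      qed
    qed
    show ?thesis
    proof (cases "(\<forall>X\<in>B. X $ 1 $ 1 = 0) \<or> (\<forall>X\<in>B. X $ 1 $ 1 = X $ 2 $ 2)")
      case True
      then have "classified (flip ` B)"
        by (intro classified_if_diagonal_relation[OF sub' dim' tri']) (auto simp: flip_nth)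
      then show ?thesis by (rule classified_equivalent[OF equivalent_flip])
    next
      case False
      with diag show ?thesis
        by (intro classified_if_diagonal_relation[OF sub dim tri]) blast+
    qed
  qed
qed

section \<open>The classification\<close>

theorem lemma5:
  fixes B :: "(complex^3^3) set"
  assumes "subalgebra B"
    and "M3.dim B = 5"
  shows "\<exists>\<phi> :: complex^3^3 \<Rightarrow> complex^3^3.
    (automorphism \<phi> \<or> antiautomorphism \<phi>) \<and>
    \<phi> ` B \<in>
      {M3.span {e 1 1, e 2 2, e 2 3, e 3 2, e 3 3},
       M3.span {e 1 1, e 1 2, e 1 3, e 2 2, e 3 3},
       M3.span {e 1 1, e 1 2, e 1 3, e 2 3, e 2 2 + e 3 3},
       M3.span {e 1 1, e 1 2, e 1 3, e 2 2, e 2 3},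
       M3.span {e 1 1, e 1 2, e 1 3, e 2 3, e 3 3},
       M3.span {e 1 1 + e 3 3, e 1 2, e 1 3, e 2 2, e 2 3}}"
proof -
  obtain C where BC: "equivalent B C" and C: "\<And>X. X \<in> C \<Longrightarrow> X $ 2 $ 1 = 0 \<and> X $ 3 $ 1 = 0"
    using equivalent_first_column[OF assms] by blast
  have sub: "subalgebra C" and dim: "M3.dim C = 5"
    using equivalent_subalgebra[OF BC] equivalent_dim[OF BC] assms by auto
  have st: "stabilizes_e1 C" using C by (auto simp: stabilizes_e1_def)
  have "classified C"
    using block_burnside[OF sub st]
  proof
    assume "\<exists>p q. block_eigenvector C p q"
    then obtain p q where "block_eigenvector C p q" by blast
    then obtain D where CD: "equivalent C D" and D: "\<And>X. X \<in> D \<Longrightarrow> upper_triangular X"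
      using equivalent_upper_triangular[OF st] by blast
    have "classified D"
      using equivalent_subalgebra[OF CD sub] equivalent_dim[OF CD] dim D
      by (intro classified_if_upper_triangular) auto
    then show ?thesis by (rule classified_equivalent[OF CD])
  next
    assume "\<forall>a b c d. \<exists>X\<in>C. X $ 2 $ 2 = a \<and> X $ 2 $ 3 = b \<and> X $ 3 $ 2 = c \<and> X $ 3 $ 3 = d"
    then show ?thesis by (intro classified_if_block_full sub dim st) blast
  qed
  then have "classified B" by (rule classified_equivalent[OF BC])
  then show ?thesis
    unfolding classified_def canonical_def equivalent_def by blast
qed

end
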